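(* Let $\kappa$ be a regular infinite cardinal, let $\pi$ be a cardinality-preserving automorphism of $\mathcal{P}(\kappa^+)/\mathcal{I}_\kappa$, let $C$ be the set of closure points of $\pi$, and let $S$ be the set of $\alpha\in C$ which are not fixed points of $\pi$. Then there exist $S_0,S_1$ with $S=S_0\cup S_1$ such that each of $S_0$ and $S_1$ supports a ladder system satisfying $2$-uniformization.
   Context: $\mathcal{I}_\kappa$ is the ideal of subsets of $\kappa^+$ of cardinality less than $\kappa$; $[A]$ is the class of $A$; $[A]\le[B]$ means $|A\setminus B|<\kappa$, and $[A]<[B]$ means $[A]\le[B]$ and $[A]\neq[B]$. An ordinal $\alpha<\kappa^+$ is identified with the set of smaller ordinals. $\pi$ is cardinality-preserving if for every $A$ there is $B$ with $|B|=|A|$ and $\pi([A])=[B]$. $\beta<\kappa^+$ is a closure point of $\pi$ if for all $\alpha<\beta$, $\pi([\alpha])<[\beta]$ and $\pi^{-1}([\alpha])<[\beta]$. An ordinal $\beta$ is a fixed point of $\pi$ if $\pi([\beta])=[\beta]$. A ladder on a limit ordinal $\alpha$ is a cofinal subset of $\alpha$ of order type $\mathrm{cf}(\alpha)$ (not necessarily closed); a ladder system on a set $T$ of limit ordinals is a sequence $\langle L_\alpha:\alpha\in T\rangle$ with each $L_\alpha$ a ladder on $\alpha$. It satisfies $2$-uniformization if for every sequence of functions $f_\alpha:L_\alpha\to 2$ ($\alpha\in T$) there is $F:\sup(T)\to 2$ such that for all $\alpha\in T$, $|\{\beta\in L_\alpha:F(\beta)\neq f_\alpha(\beta)\}|<\kappa$.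 *)

theory Defs
  imports Main
begin

unbundle cardinal_syntax

text \<open>
  An ordinal is represented by a well-order \<open>W\<close>; the ordinals below it are the elements of
  \<open>Field W\<close>, and \<open>\<alpha> \<in> Field W\<close> is identified with the set \<open>underS W \<alpha>\<close> of its strict
  predecessors. Cardinals \<open>k\<close> are the initial well-orders of the library (\<open>Card_order k\<close>),
  and \<open>k\<close>'s successor cardinal is \<open>cardSuc k\<close>.
\<close>

section \<open>The Boolean algebra of subsets of \<open>U\<close> modulo sets of cardinality less than \<open>k\<close>\<close>

definition small_ideal :: "'k rel \<Rightarrow> 'a set \<Rightarrow> 'a set set" where
  "small_ideal k U = {A. A \<subseteq> U \<and> |A| <o k}"

definition ideal_rel :: "'k rel \<Rightarrow> 'a set \<Rightarrow> 'a set rel" where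
  "ideal_rel k U = {(A, B). A \<subseteq> U \<and> B \<subseteq> U \<and> sym_diff A B \<in> small_ideal k U}"

definition cls :: "'k rel \<Rightarrow> 'a set \<Rightarrow> 'a set \<Rightarrow> 'a set set" where
  "cls k U A = ideal_rel k U `` {A}"

definition quot :: "'k rel \<Rightarrow> 'a set \<Rightarrow> 'a set set set" where
  "quot k U = Pow U // ideal_rel k U"

definition quot_join :: "'k rel \<Rightarrow> 'a set \<Rightarrow> 'a set set \<Rightarrow> 'a set set \<Rightarrow> 'a set set" where
  "quot_join k U X Y = (\<Union>A\<in>X. \<Union>B\<in>Y. cls k U (A \<union> B))"

definition quot_meet :: "'k rel \<Rightarrow> 'a set \<Rightarrow> 'a set set \<Rightarrow> 'a set set \<Rightarrow> 'a set set" where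
  "quot_meet k U X Y = (\<Union>A\<in>X. \<Union>B\<in>Y. cls k U (A \<inter> B))"

definition quot_compl :: "'k rel \<Rightarrow> 'a set \<Rightarrow> 'a set set \<Rightarrow> 'a set set" where
  "quot_compl k U X = (\<Union>A\<in>X. cls k U (U - A))"

definition quot_le :: "'k rel \<Rightarrow> 'a set set \<Rightarrow> 'a set set \<Rightarrow> bool" where
  "quot_le k X Y \<longleftrightarrow> (\<forall>A\<in>X. \<forall>B\<in>Y. |A - B| <o k)"

definition quot_less :: "'k rel \<Rightarrow> 'a set set \<Rightarrow> 'a set set \<Rightarrow> bool" where
  "quot_less k X Y \<longleftrightarrow> quot_le k X Y \<and> X \<noteq> Y"

definition quot_automorphism ::
    "'k rel \<Rightarrow> 'a set \<Rightarrow> ('a set set \<Rightarrow> 'a set set) \<Rightarrow> bool" where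
  "quot_automorphism k U \<pi> \<longleftrightarrow>
     bij_betw \<pi> (quot k U) (quot k U) \<and>
     (\<forall>X\<in>quot k U. \<forall>Y\<in>quot k U. \<pi> (quot_join k U X Y) = quot_join k U (\<pi> X) (\<pi> Y)) \<and>
     (\<forall>X\<in>quot k U. \<forall>Y\<in>quot k U. \<pi> (quot_meet k U X Y) = quot_meet k U (\<pi> X) (\<pi> Y)) \<and>
     (\<forall>X\<in>quot k U. \<pi> (quot_compl k U X) = quot_compl k U (\<pi> X))"

definition card_preserving ::
    "'k rel \<Rightarrow> 'a set \<Rightarrow> ('a set set \<Rightarrow> 'a set set) \<Rightarrow> bool" where
  "card_preserving k U \<pi> \<longleftrightarrow>
     (\<forall>A\<subseteq>U. \<exists>B\<subseteq>U. |B| =o |A| \<and> \<pi> (cls k U A) = cls k U B)"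

section \<open>Closure points and fixed points\<close>

abbreviation ord_cls :: "'k rel \<Rightarrow> 'a rel \<Rightarrow> 'a \<Rightarrow> 'a set set" where
  "ord_cls k W \<alpha> \<equiv> cls k (Field W) (underS W \<alpha>)"

definition closure_point ::
    "'k rel \<Rightarrow> 'a rel \<Rightarrow> ('a set set \<Rightarrow> 'a set set) \<Rightarrow> 'a \<Rightarrow> bool" where
  "closure_point k W \<pi> \<beta> \<longleftrightarrow> \<beta> \<in> Field W \<and>
     (\<forall>\<alpha>\<in>underS W \<beta>.
        quot_less k (\<pi> (ord_cls k W \<alpha>)) (ord_cls k W \<beta>) \<and>
        quot_less k (inv_into (quot k (Field W)) \<pi> (ord_cls k W \<alpha>)) (ord_cls k W \<beta>))"

definition fixed_point ::
    "'k rel \<Rightarrow> 'a rel \<Rightarrow> ('a set set \<Rightarrow> 'a set set) \<Rightarrow> 'a \<Rightarrow> bool" where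
  "fixed_point k W \<pi> \<beta> \<longleftrightarrow> \<pi> (ord_cls k W \<beta>) = ord_cls k W \<beta>"

section \<open>Ladder systems\<close>

definition limit_ordinal :: "'a rel \<Rightarrow> 'a \<Rightarrow> bool" where
  "limit_ordinal W \<alpha> \<longleftrightarrow> \<alpha> \<in> Field W \<and> underS W \<alpha> \<noteq> {} \<and>
     (\<forall>\<beta>\<in>underS W \<alpha>. \<exists>\<gamma>\<in>underS W \<alpha>. \<beta> \<in> underS W \<gamma>)"

definition cofinal_below :: "'a rel \<Rightarrow> 'a \<Rightarrow> 'a set \<Rightarrow> bool" where
  "cofinal_below W \<alpha> L \<longleftrightarrow> L \<subseteq> underS W \<alpha> \<and> (\<forall>\<beta>\<in>underS W \<alpha>. \<exists>\<gamma>\<in>L. (\<beta>, \<gamma>) \<in> W)"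

text \<open>
  \<open>cof W \<alpha>\<close> is the least cardinality of a cofinal subset of \<open>\<alpha>\<close>. It is a well-order that is
  determined up to \<open>=o\<close> only, so it is to be compared by \<open>=o\<close>.
\<close>

definition cof :: "'a rel \<Rightarrow> 'a \<Rightarrow> 'a rel" where
  "cof W \<alpha> = (SOME c. \<exists>L. cofinal_below W \<alpha> L \<and> c = |L| \<and>
                 (\<forall>L'. cofinal_below W \<alpha> L' \<longrightarrow> |L| \<le>o |L'| ))"

definition ladder :: "'a rel \<Rightarrow> 'a \<Rightarrow> 'a set \<Rightarrow> bool" where
  "ladder W \<alpha> L \<longleftrightarrow> limit_ordinal W \<alpha> \<and> cofinal_below W \<alpha> L \<and> Restr W L =o cof W \<alpha>"

definition ladder_system :: "'a rel \<Rightarrow> 'a set \<Rightarrow> ('a \<Rightarrow> 'a set) \<Rightarrow> bool" where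
  "ladder_system W T L \<longleftrightarrow> (\<forall>\<alpha>\<in>T. ladder W \<alpha> (L \<alpha>))"

text \<open>
  The set \<open>2\<close> is \<open>bool\<close>. The functions \<open>f \<alpha>\<close> and \<open>F\<close> are total; only the values of \<open>f \<alpha>\<close>
  on \<open>L \<alpha>\<close> and the values of \<open>F\<close> on the ladders, which lie below \<open>sup T\<close>, are used.
\<close>

definition two_uniformization :: "'k rel \<Rightarrow> 'a set \<Rightarrow> ('a \<Rightarrow> 'a set) \<Rightarrow> bool" where
  "two_uniformization k T L \<longleftrightarrow>
     (\<forall>f :: 'a \<Rightarrow> 'a \<Rightarrow> bool. \<exists>F :: 'a \<Rightarrow> bool.
        \<forall>\<alpha>\<in>T. |{\<beta> \<in> L \<alpha>. F \<beta> \<noteq> f \<alpha> \<beta>}| <o k)"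

section \<open>The operations are well defined\<close>

context
  fixes k :: "'k rel" and U :: "'a set"
  assumes k: "Card_order k" "infinite (Field k)"
begin

lemma small_Un: "|A| <o k \<Longrightarrow> |B| <o k \<Longrightarrow> |A \<union> B| <o k" for A B :: "'b set"
  using card_of_Un_ordLess_infinite_Field[OF k(2,1)] by blast

lemma small_mono: "A \<subseteq> B \<Longrightarrow> |B| <o k \<Longrightarrow> |A| <o k" for A B :: "'b set"
  using card_of_mono1 ordLeq_ordLess_trans by blast

lemma small_empty: "|{} :: 'b set| <o k"
  using k finite_ordLess_infinite[of "|{} :: 'b set|" k]
  by (simp add: card_of_well_order_on card_order_on_well_order_on Field_card_of)

lemma ideal_rel_iff:
  "(A, B) \<in> ideal_rel k U \<longleftrightarrow> A \<subseteq> U \<and> B \<subseteq> U \<and> |A - B| <o k \<and> |B - A| <o k"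
  unfolding ideal_rel_def small_ideal_def
  by (auto intro: small_Un small_mono[of _ "sym_diff A B"])

lemma equiv_ideal_rel: "equiv (Pow U) (ideal_rel k U)"
proof (rule equivI)
  show "ideal_rel k U \<subseteq> Pow U \<times> Pow U"
    by (auto simp: ideal_rel_def)
  show "refl_on (Pow U) (ideal_rel k U)"
    by (auto simp: refl_on_def ideal_rel_iff small_empty)
  show "sym (ideal_rel k U)"
    by (auto simp: sym_def ideal_rel_iff)
  show "trans (ideal_rel k U)"
  proof (rule transI)
    fix A B C assume "(A, B) \<in> ideal_rel k U" "(B, C) \<in> ideal_rel k U"
    then show "(A, C) \<in> ideal_rel k U"
      unfolding ideal_rel_iff
      using small_mono[of "A - C" "(A - B) \<union> (B - C)"] small_mono[of "C - A" "(C - B) \<union> (B - A)"]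
        small_Un by blast
  qed
qed

lemma cls_eq_iff:
  assumes "A \<subseteq> U" "B \<subseteq> U"
  shows "cls k U A = cls k U B \<longleftrightarrow> |A - B| <o k \<and> |B - A| <o k"
  using assms eq_equiv_class_iff[OF equiv_ideal_rel, of A B] by (simp add: cls_def ideal_rel_iff)

lemma quot_le_cls:
  assumes "A \<subseteq> U" "B \<subseteq> U"
  shows "quot_le k (cls k U A) (cls k U B) \<longleftrightarrow> |A - B| <o k"
proof
  assume "quot_le k (cls k U A) (cls k U B)"
  then show "|A - B| <o k"
    using assms by (auto simp: quot_le_def cls_def ideal_rel_iff small_empty)
next
  assume *: "|A - B| <o k"
  show "quot_le k (cls k U A) (cls k U B)"
    unfolding quot_le_def
  proof (intro ballI)
    fix A' B' assume "A' \<in> cls k U A" "B' \<in> cls k U B"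
    then have "|A' - A| <o k" "|B - B'| <o k"
      by (auto simp: cls_def ideal_rel_iff)
    then show "|A' - B'| <o k"
      using * small_Un small_mono[of "A' - B'" "(A' - A) \<union> ((A - B) \<union> (B - B'))"] by blast
  qed
qed

lemma quot_join_cls:
  assumes "A \<subseteq> U" "B \<subseteq> U"
  shows "quot_join k U (cls k U A) (cls k U B) = cls k U (A \<union> B)"
  unfolding quot_join_def cls_def
proof (rule UN_equiv_class2[OF equiv_ideal_rel equiv_ideal_rel])
  show "congruent2 (ideal_rel k U) (ideal_rel k U) (\<lambda>A B. ideal_rel k U `` {A \<union> B})"
  proof (rule congruent2I')
    fix A A' B B' assume *: "(A, A') \<in> ideal_rel k U" "(B, B') \<in> ideal_rel k U"
    then have "(A \<union> B, A' \<union> B') \<in> ideal_rel k U"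
      unfolding ideal_rel_iff
      using small_mono[of "A \<union> B - (A' \<union> B')" "(A - A') \<union> (B - B')"]
        small_mono[of "A' \<union> B' - (A \<union> B)" "(A' - A) \<union> (B' - B)"] small_Un by blast
    then show "ideal_rel k U `` {A \<union> B} = ideal_rel k U `` {A' \<union> B'}"
      by (rule equiv_class_eq[OF equiv_ideal_rel])
  qed
qed (use assms in auto)

lemma quot_meet_cls:
  assumes "A \<subseteq> U" "B \<subseteq> U"
  shows "quot_meet k U (cls k U A) (cls k U B) = cls k U (A \<inter> B)"
  unfolding quot_meet_def cls_def
proof (rule UN_equiv_class2[OF equiv_ideal_rel equiv_ideal_rel])
  show "congruent2 (ideal_rel k U) (ideal_rel k U) (\<lambda>A B. ideal_rel k U `` {A \<inter> B})"
  proof (rule congruent2I')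
    fix A A' B B' assume *: "(A, A') \<in> ideal_rel k U" "(B, B') \<in> ideal_rel k U"
    then have "(A \<inter> B, A' \<inter> B') \<in> ideal_rel k U"
      unfolding ideal_rel_iff
      using small_mono[of "A \<inter> B - (A' \<inter> B')" "(A - A') \<union> (B - B')"]
        small_mono[of "A' \<inter> B' - (A \<inter> B)" "(A' - A) \<union> (B' - B)"] small_Un by blast
    then show "ideal_rel k U `` {A \<inter> B} = ideal_rel k U `` {A' \<inter> B'}"
      by (rule equiv_class_eq[OF equiv_ideal_rel])
  qed
qed (use assms in auto)

lemma quot_compl_cls:
  assumes "A \<subseteq> U"
  shows "quot_compl k U (cls k U A) = cls k U (U - A)"
  unfolding quot_compl_def cls_def
proof (rule UN_equiv_class[OF equiv_ideal_rel])
  show "(\<lambda>A. ideal_rel k U `` {U - A}) respects ideal_rel k U"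
  proof (rule congruentI)
    fix A A' assume *: "(A, A') \<in> ideal_rel k U"
    then have "(U - A, U - A') \<in> ideal_rel k U"
      unfolding ideal_rel_iff
      using small_mono[of "U - A - (U - A')" "A' - A"]
        small_mono[of "U - A' - (U - A)" "A - A'"] by blast
    then show "ideal_rel k U `` {U - A} = ideal_rel k U `` {U - A'}"
      by (rule equiv_class_eq[OF equiv_ideal_rel])
  qed
qed (use assms in auto)

end

lemma cof_least:
  assumes "Well_order W"
  shows "\<exists>L. cofinal_below W \<alpha> L \<and> cof W \<alpha> = |L| \<and>
            (\<forall>L'. cofinal_below W \<alpha> L' \<longrightarrow> |L| \<le>o |L'| )"
proof -
  have "Refl W"
    using assms by (simp add: order_on_defs)
  then have "cofinal_below W \<alpha> (underS W \<alpha>)"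
    by (auto simp: cofinal_below_def underS_def refl_on_def Field_def)
  then have ne: "card_of ` {L. cofinal_below W \<alpha> L} \<noteq> {}"
    by blast
  have "\<exists>c L. cofinal_below W \<alpha> L \<and> c = |L| \<and>
            (\<forall>L'. cofinal_below W \<alpha> L' \<longrightarrow> |L| \<le>o |L'| )"
    using exists_minim_Card_order[OF ne] by (auto simp: card_of_Card_order)
  then show ?thesis
    unfolding cof_def by (rule someI_ex)
qed

end

theory Submission
  imports Defs
begin

text \<open>
  Lift \<open>\<pi>\<close> and its inverse to maps \<open>p\<close>, \<open>q\<close> of subsets of \<open>U\<close>, and let \<open>T\<close> be the set of
  closure points \<open>\<alpha>\<close> at which \<open>p \<alpha> - \<alpha>\<close> is not small. The set \<open>D \<alpha> = q (p \<alpha> - \<alpha>) \<inter> \<alpha>\<close> is not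
  small, but it meets every \<open>\<gamma> < \<alpha>\<close> in a small set because \<open>p \<gamma>\<close> is almost contained in \<open>\<alpha>\<close>;
  hence it has order type \<open>\<kappa>\<close> and is a ladder. Moreover \<open>p (D \<alpha>)\<close> lies, up to a small set, between
  \<open>\<alpha>\<close> and the next element of \<open>T\<close>, so these images can be taken pairwise disjoint for
  different \<open>\<alpha>\<close>. Disjoint sets are trivially uniformized by a union, and \<open>q\<close> carries this union
  back to a uniformizing function. An \<open>\<alpha>\<close> in \<open>S\<close> is of this kind for \<open>\<pi>\<close> or for its inverse.
\<close>

section \<open>Inclusion modulo small sets and maps invertible up to it\<close>

definition almost_subset :: "'k rel \<Rightarrow> 'a set \<Rightarrow> 'a set \<Rightarrow> bool" where
  "almost_subset k A B \<longleftrightarrow> |A - B| <o k"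

text \<open>Since \<open>p\<close> and \<open>q\<close> act on representatives, they are monotone
  and mutually inverse only up to small sets. The axioms are symmetric in \<open>p\<close> and
  \<open>q\<close>, so the locale can be interpreted again with the two exchanged.\<close>

locale almost_iso =
  fixes k :: "'k rel" and U :: "'a set" and p q :: "'a set \<Rightarrow> 'a set"
  assumes card_order: "Card_order k" and infinite_Field: "infinite (Field k)"
    and p_subset: "A \<subseteq> U \<Longrightarrow> p A \<subseteq> U"
    and q_subset: "A \<subseteq> U \<Longrightarrow> q A \<subseteq> U"
    and p_mono: "A \<subseteq> U \<Longrightarrow> B \<subseteq> U \<Longrightarrow> almost_subset k A B \<Longrightarrow> almost_subset k (p A) (p B)"
    and q_mono: "A \<subseteq> U \<Longrightarrow> B \<subseteq> U \<Longrightarrow> almost_subset k A B \<Longrightarrow> almost_subset k (q A) (q B)"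
    and pq_le: "A \<subseteq> U \<Longrightarrow> almost_subset k (p (q A)) A"
    and pq_ge: "A \<subseteq> U \<Longrightarrow> almost_subset k A (p (q A))"
    and qp_le: "A \<subseteq> U \<Longrightarrow> almost_subset k (q (p A)) A"
    and qp_ge: "A \<subseteq> U \<Longrightarrow> almost_subset k A (q (p A))"
begin

lemmas small_Un = small_Un[OF card_order infinite_Field]
lemmas small_mono = small_mono[OF card_order infinite_Field]
lemmas small_empty = small_empty[OF card_order infinite_Field]

abbreviation sub (infix "\<lesssim>" 50) where "A \<lesssim> B \<equiv> almost_subset k A B"

lemma sub_subset: "A \<subseteq> B \<Longrightarrow> A \<lesssim> B" for A :: "'b set"
  unfolding almost_subset_def by (metis Diff_eq_empty_iff small_empty)

lemma sub_trans [trans]: "A \<lesssim> B \<Longrightarrow> B \<lesssim> C \<Longrightarrow> A \<lesssim> C" for A :: "'b set"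
  unfolding almost_subset_def
  using small_mono[of "A - C" "(A - B) \<union> (B - C)"] small_Un by blast

lemma sub_Int: "A \<lesssim> B \<Longrightarrow> A \<lesssim> C \<Longrightarrow> A \<lesssim> B \<inter> C" for A :: "'b set"
  unfolding almost_subset_def using small_Un[of "A - B" "A - C"] by (simp add: Diff_Int)

lemma sub_empty_iff: "A \<lesssim> {} \<longleftrightarrow> |A| <o k" for A :: "'b set"
  by (simp add: almost_subset_def)

lemma p_empty: "p {} \<lesssim> {}"
proof -
  have "p {} \<lesssim> p (q {})"
    by (intro p_mono sub_subset q_subset) auto
  then show ?thesis
    using sub_trans pq_le by blast
qed

text \<open>\<open>q\<close> sends \<open>p A \<inter> p B\<close> almost into \<open>A\<close> and
  almost into \<open>B\<close>, hence almost into \<open>A \<inter> B\<close>; applying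
  \<open>p\<close> brings this back.\<close>

lemma p_Int:
  assumes "A \<subseteq> U" "B \<subseteq> U"
  shows "p A \<inter> p B \<lesssim> p (A \<inter> B)"
proof -
  have sub: "p A \<subseteq> U" "p A \<inter> p B \<subseteq> U" "p B \<subseteq> U"
    using assms p_subset by blast+
  have le: "q (p A \<inter> p B) \<lesssim> q (p A)" "q (p A \<inter> p B) \<lesssim> q (p B)"
    by (intro q_mono sub_subset; use sub in blast)+
  have "q (p A \<inter> p B) \<lesssim> A \<inter> B"
    by (intro sub_Int sub_trans[OF le(1) qp_le] sub_trans[OF le(2) qp_le] assms)
  then have "p (q (p A \<inter> p B)) \<lesssim> p (A \<inter> B)"
    by (intro p_mono q_subset sub) (use assms in blast)
  then show ?thesis
    by (rule sub_trans[OF pq_ge[OF sub(2)]])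
qed

lemma p_reflects:
  assumes "A \<subseteq> U" "B \<subseteq> U" "p A \<lesssim> p B"
  shows "A \<lesssim> B"
proof -
  have "q (p A) \<lesssim> q (p B)"
    by (intro q_mono p_subset assms)
  then show ?thesis
    by (rule sub_trans[OF sub_trans[OF qp_ge[OF assms(1)]] qp_le[OF assms(2)]])
qed

lemma p_reflects_empty:
  assumes "A \<subseteq> U" "p A \<lesssim> {}"
  shows "A \<lesssim> {}"
  by (rule p_reflects[OF assms(1) _ sub_trans[OF assms(2) sub_subset]]) auto

end

section \<open>Order type and cofinality of ladders\<close>

text \<open>\<open>W\<close> is at least as long as the cardinal of its field, hence as
  \<open>k\<close>. Were it longer, a proper initial segment would be isomorphic to \<open>k\<close>
  and not small.\<close>

lemma ordIso_if_initial_segments_small: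
  assumes k: "Card_order k" and W: "Well_order W"
    and large: "\<not> |Field W| <o k" and small: "\<And>a. a \<in> Field W \<Longrightarrow> |underS W a| <o k"
  shows "W =o k"
proof -
  have wk: "Well_order k"
    using k by (simp add: card_order_on_def)
  have "k \<le>o |Field W|"
    using large wk card_of_Well_order not_ordLess_iff_ordLeq by blast
  then have "k \<le>o W"
    using card_of_least[OF W] ordLeq_transitive by blast
  moreover have "\<not> k <o W"
  proof
    assume "k <o W"
    then obtain a where a: "a \<in> Field W" "k =o Restr W (underS W a)"
      using ordLess_iff_ordIso_Restr[OF W wk] by blast
    have "|Field k| =o |Field (Restr W (underS W a))|"
      using a(2) by (rule card_of_cong)
    then have "k =o |Field (Restr W (underS W a))|"
      using card_of_Field_ordIso[OF k] ordIso_symmetric ordIso_transitive by blast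
    moreover have "|Field (Restr W (underS W a))| \<le>o |underS W a|"
      by (rule card_of_mono1) (rule Field_Restr_subset)
    ultimately have "k \<le>o |underS W a|"
      using ordIso_ordLeq_trans by blast
    then show False
      using small[OF a(1)] not_ordLeq_ordLess by blast
  qed
  ultimately show ?thesis
    using W wk not_ordLess_iff_ordLeq ordIso_iff_ordLeq by blast
qed

text \<open>Small initial segments give \<open>D\<close> the order type \<open>k\<close>. By
  regularity the cofinality of \<open>\<alpha>\<close> is also \<open>k\<close>: a smaller cofinal
  set would split \<open>D\<close> into fewer than \<open>k\<close> small pieces.\<close>

lemma ladder_if_initial_segments_small:
  fixes k :: "'k rel" and W :: "'a rel"
  assumes k: "Card_order k" "infinite (Field k)" "regularCard k" and W: "Well_order W"
    and \<alpha>: "\<alpha> \<in> Field W" and D: "D \<subseteq> underS W \<alpha>" and large: "\<not> |D| <o k"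
    and small: "\<And>\<gamma>. \<gamma> \<in> underS W \<alpha> \<Longrightarrow> |D \<inter> underS W \<gamma>| <o k"
  shows "ladder W \<alpha> D"
proof -
  have wk: "Well_order k"
    using k by (simp add: card_order_on_def)
  have WF: "Linear_order W" "Total W" "Refl W" "trans W" "antisym W"
    using W by (auto simp: order_on_defs)
  have small1: "|insert x A| <o k" if "|A| <o k" for A :: "'a set" and x
    using that card_of_Un_ordLess_infinite_Field[OF k(2,1), of "{x}" A]
      finite_ordLess_infinite[OF card_of_Well_order[of "{x}"] wk] k(2)
    by (simp add: Field_card_of)
  \<comment> \<open>Strictness serves twice: it makes \<open>D\<close> cofinal and, as
    \<open>D\<close> lies below \<open>\<alpha>\<close>, makes \<open>\<alpha>\<close> a
    limit.\<close>
  have above: "\<exists>\<delta>\<in>D. \<gamma> \<in> underS W \<delta>" if \<gamma>: "\<gamma> \<in> underS W \<alpha>" for \<gamma>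
  proof (rule ccontr)
    assume *: "\<not> ?thesis"
    have "D \<subseteq> insert \<gamma> (D \<inter> underS W \<gamma>)"
    proof
      fix \<delta> assume \<delta>: "\<delta> \<in> D"
      then have "\<delta> \<in> Field W" "\<gamma> \<in> Field W"
        using D \<gamma> by (auto simp: underS_def Field_def)
      then have "\<delta> = \<gamma> \<or> (\<gamma>, \<delta>) \<in> W \<or> (\<delta>, \<gamma>) \<in> W"
        using WF(2) by (metis total_on_def)
      then show "\<delta> \<in> insert \<gamma> (D \<inter> underS W \<gamma>)"
        using * \<delta> by (auto simp: underS_def)
    qed
    then have "|D| <o k"
      using small1[OF small[OF \<gamma>], of \<gamma>] card_of_mono1 ordLeq_ordLess_trans by blast
    with large show False by simp
  qed
  have cofin: "cofinal_below W \<alpha> D"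
    unfolding cofinal_below_def using D above by (fastforce simp: underS_def)
  have "D \<noteq> {}"
    using large small_empty[OF k(1,2)] by auto
  then have lim: "limit_ordinal W \<alpha>"
    unfolding limit_ordinal_def using \<alpha> D above by blast
  have DF: "D \<subseteq> Field W"
    using D by (auto simp: underS_def Field_def)
  have FD: "Field (Restr W D) = D"
    using Refl_Field_Restr2[OF WF(3) DF] .
  have Dk: "Restr W D =o k"
  proof (rule ordIso_if_initial_segments_small[OF k(1) Well_order_Restr[OF W]])
    fix a assume "a \<in> Field (Restr W D)"
    then have a: "a \<in> underS W \<alpha>"
      using FD D by auto
    have "underS (Restr W D) a \<subseteq> D \<inter> underS W a"
      by (auto simp: underS_def)
    then show "|underS (Restr W D) a| <o k"
      using small[OF a] card_of_mono1 ordLeq_ordLess_trans by blast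
  qed (use FD large in simp)
  have "|D| \<le>o k"
    using card_of_least[OF well_order_on_Restr[OF W DF]] Dk ordLeq_ordIso_trans by blast
  obtain L where L: "cofinal_below W \<alpha> L" "cof W \<alpha> = |L|"
    "\<And>L'. cofinal_below W \<alpha> L' \<Longrightarrow> |L| \<le>o |L'|"
    using cof_least[OF W] by blast
  have "|L| \<le>o k"
    using L(3)[OF cofin] \<open>|D| \<le>o k\<close> ordLeq_transitive by blast
  moreover have "\<not> |L| <o k"
  proof
    assume Lk: "|L| <o k"
    \<comment> \<open>The point \<open>l\<close> itself is inserted because cofinality uses the
      reflexive order, so an element of \<open>D\<close> may equal its bound in
      \<open>L\<close>.\<close>
    have "|\<Union>l\<in>L. insert l (D \<inter> underS W l)| <o k"
      using regularCard_stable[OF k] Lk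
    proof (rule stable_UNION)
      fix l assume "l \<in> L"
      then show "|insert l (D \<inter> underS W l)| <o k"
        using L(1) by (auto simp: cofinal_below_def intro!: small1 small)
    qed
    moreover have "D \<subseteq> (\<Union>l\<in>L. insert l (D \<inter> underS W l))"
      using L(1) D unfolding cofinal_below_def underS_def by fastforce
    ultimately show False
      using large card_of_mono1 ordLeq_ordLess_trans by blast
  qed
  ultimately have "|L| =o k"
    using ordLeq_iff_ordLess_or_ordIso by blast
  then have "Restr W D =o cof W \<alpha>"
    using Dk L(2) ordIso_symmetric ordIso_transitive by metis
  then show ?thesis
    unfolding ladder_def using lim cofin by blast
qed

section \<open>Uniformization at points moved outward\<close>

lemma (in almost_iso) two_uniformization_of_moved_points:
  assumes reg: "regularCard k" and W: "Well_order W" and U: "U = Field W"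
    and T: "T \<subseteq> Field W"
    and closed: "\<And>\<alpha> \<gamma>. \<alpha> \<in> T \<Longrightarrow> \<gamma> \<in> underS W \<alpha> \<Longrightarrow> p (underS W \<gamma>) \<lesssim> underS W \<alpha>"
    and moved: "\<And>\<alpha>. \<alpha> \<in> T \<Longrightarrow> \<not> p (underS W \<alpha>) \<lesssim> underS W \<alpha>"
  shows "\<exists>L. ladder_system W T L \<and> two_uniformization k T L"
proof -
  have WF: "Total W" "Refl W" "trans W" "antisym W"
    using W by (auto simp: order_on_defs)
  have usU [simp]: "underS W \<alpha> \<subseteq> U" for \<alpha>
    using U by (auto simp: underS_def Field_def)
  have pU [simp]: "p (underS W \<alpha>) \<subseteq> U" for \<alpha>
    by (simp add: p_subset)
  define M where "M \<alpha> = p (underS W \<alpha>) - underS W \<alpha>" for \<alpha>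
  have MU [simp]: "M \<alpha> \<subseteq> U" for \<alpha>
    unfolding M_def using pU by blast
  \<comment> \<open>\<open>q (M \<alpha>)\<close> is only almost contained in
    \<open>\<alpha>\<close>, whereas a ladder must lie below \<open>\<alpha>\<close>
    exactly.\<close>
  define D where "D \<alpha> = q (M \<alpha>) \<inter> underS W \<alpha>" for \<alpha>
  have DU [simp]: "D \<alpha> \<subseteq> U" for \<alpha>
    unfolding D_def using usU by blast
  have pD_le: "p (D \<alpha>) \<lesssim> M \<alpha>" for \<alpha>
  proof -
    have "p (D \<alpha>) \<lesssim> p (q (M \<alpha>))"
      by (intro p_mono sub_subset) (auto simp: D_def q_subset usU[THEN subsetD])
    also have "\<dots> \<lesssim> M \<alpha>"
      by (simp add: pq_le)
    finally show ?thesis .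
  qed
  \<comment> \<open>As \<open>M \<alpha>\<close> is part of \<open>p (underS W \<alpha>)\<close>,
    cutting \<open>q (M \<alpha>)\<close> down to \<open>\<alpha>\<close> loses only a small
    set.\<close>
  have pD_ge: "M \<alpha> \<lesssim> p (D \<alpha>)" for \<alpha>
  proof -
    have "M \<alpha> \<lesssim> p (q (M \<alpha>)) \<inter> p (underS W \<alpha>)"
      by (intro sub_Int pq_ge MU sub_subset) (auto simp: M_def)
    also have "\<dots> \<lesssim> p (D \<alpha>)"
      unfolding D_def by (intro p_Int q_subset) auto
    finally show ?thesis .
  qed
  have large: "\<not> |D \<alpha>| <o k" if "\<alpha> \<in> T" for \<alpha>
  proof
    assume "|D \<alpha>| <o k"
    then have "p (D \<alpha>) \<lesssim> p {}"
      by (intro p_mono) (auto simp: sub_empty_iff DU[THEN subsetD])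
    then have "M \<alpha> \<lesssim> {}"
      using pD_ge p_empty sub_trans by blast
    then show False
      using moved[OF that] by (simp add: M_def almost_subset_def)
  qed
  \<comment> \<open>The image under \<open>p\<close> lies almost in \<open>M \<alpha>\<close> and,
    by closure, almost in \<open>underS W \<alpha>\<close>. These are disjoint, so the image is
    small, and hence so is the set.\<close>
  have small: "|D \<alpha> \<inter> underS W \<gamma>| <o k" if "\<alpha> \<in> T" "\<gamma> \<in> underS W \<alpha>" for \<alpha> \<gamma>
  proof -
    have sub: "D \<alpha> \<inter> underS W \<gamma> \<subseteq> U"
      using DU[of \<alpha>] by blast
    have "p (D \<alpha> \<inter> underS W \<gamma>) \<lesssim> p (D \<alpha>)"
      by (rule p_mono[OF sub]) (auto intro: sub_subset)
    moreover have "p (D \<alpha> \<inter> underS W \<gamma>) \<lesssim> p (underS W \<gamma>)"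
      by (rule p_mono[OF sub]) (auto intro: sub_subset)
    ultimately have "p (D \<alpha> \<inter> underS W \<gamma>) \<lesssim> M \<alpha> \<inter> underS W \<alpha>"
      using pD_le closed[OF that] sub_trans sub_Int by blast
    also have "M \<alpha> \<inter> underS W \<alpha> = {}"
      by (auto simp: M_def)
    finally show ?thesis
      using p_reflects_empty[OF sub] sub_empty_iff by blast
  qed
  have "ladder_system W T D"
    unfolding ladder_system_def
  proof
    fix \<alpha> assume \<alpha>: "\<alpha> \<in> T"
    show "ladder W \<alpha> (D \<alpha>)"
      by (rule ladder_if_initial_segments_small[OF card_order infinite_Field reg W])
        (use \<alpha> T large small in \<open>auto simp: D_def\<close>)
  qed
  moreover have "two_uniformization k T D"
    unfolding two_uniformization_def
  proof
    fix f :: "'a \<Rightarrow> 'a \<Rightarrow> bool"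
    \<comment> \<open>The half-open interval from \<open>\<alpha>\<close> to the next element of
      \<open>T\<close>, or to the end of \<open>U\<close> if there is none.\<close>
    define block where
      "block \<alpha> = {\<xi> \<in> U - underS W \<alpha>. \<forall>\<beta>\<in>T. \<alpha> \<in> underS W \<beta> \<longrightarrow> \<xi> \<in> underS W \<beta>}" for \<alpha>
    have block: "p (D \<alpha>) \<lesssim> block \<alpha>" if \<alpha>: "\<alpha> \<in> T" for \<alpha>
    proof (cases "\<exists>\<beta>\<in>T. \<alpha> \<in> underS W \<beta>")
      case False
      then have "M \<alpha> \<subseteq> block \<alpha>"
        using MU[THEN subsetD, of _ \<alpha>] by (auto simp: block_def M_def)
      then show ?thesis
        using pD_le sub_subset sub_trans by blast
    next
      case True
      let ?B = "{\<beta>\<in>T. \<alpha> \<in> underS W \<beta>}"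
      \<comment> \<open>Closure is applied only at the least element of \<open>T\<close> above
        \<open>\<alpha>\<close>. The later elements then follow exactly, so a single small error
        covers them all.\<close>
      obtain \<beta> where \<beta>: "\<beta> \<in> ?B" "\<And>\<gamma>. \<gamma> \<in> ?B \<Longrightarrow> (\<beta>, \<gamma>) \<in> W"
      proof -
        have "?B \<subseteq> Field W" "?B \<noteq> {}"
          using T True by auto
        then obtain \<beta> where "\<beta> \<in> ?B" "\<forall>\<gamma>\<in>?B. (\<beta>, \<gamma>) \<in> W"
          using W by (meson well_order_on_def Linear_order_Well_order_iff)
        then show ?thesis using that by blast
      qed
      have "p (D \<alpha>) \<lesssim> p (underS W \<alpha>)"
        by (intro p_mono sub_subset) (auto simp: D_def usU[THEN subsetD])
      also have "p (underS W \<alpha>) \<lesssim> underS W \<beta>"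
        using closed \<beta>(1) by blast
      finally have "p (D \<alpha>) \<lesssim> M \<alpha> \<inter> underS W \<beta>"
        using pD_le sub_Int by blast
      also have "M \<alpha> \<inter> underS W \<beta> \<lesssim> block \<alpha>"
      proof (rule sub_subset, rule subsetI)
        fix \<xi> assume \<xi>: "\<xi> \<in> M \<alpha> \<inter> underS W \<beta>"
        have "\<xi> \<in> underS W \<gamma>" if "\<gamma> \<in> ?B" for \<gamma>
          using \<beta>(2)[OF that] \<xi> WF(3,4) by (auto simp: underS_def dest: transD antisymD)
        then show "\<xi> \<in> block \<alpha>"
          using \<xi> MU[THEN subsetD, of \<xi> \<alpha>] by (auto simp: block_def M_def)
      qed
      finally show ?thesis .
    qed
    have disjoint: "block \<alpha> \<inter> block \<beta> = {}" if "\<alpha> \<in> T" "\<beta> \<in> T" "\<alpha> \<noteq> \<beta>" for \<alpha> \<beta>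
    proof -
      have "\<alpha> \<in> underS W \<beta> \<or> \<beta> \<in> underS W \<alpha>"
        using that T WF(1) by (auto simp: underS_def total_on_def)
      then show ?thesis
        using that by (auto simp: block_def)
    qed
    define D1 where "D1 \<alpha> = {\<beta> \<in> D \<alpha>. f \<alpha> \<beta>}" for \<alpha>
    have D1U [simp]: "D1 \<alpha> \<subseteq> U" for \<alpha>
      unfolding D1_def using DU by blast
    have D1D: "p (D1 \<alpha>) \<lesssim> p (D \<alpha>)" for \<alpha>
      by (intro p_mono sub_subset) (auto simp: D1_def DU[THEN subsetD])
    \<comment> \<open>Cutting to blocks makes the pieces literally disjoint, so \<open>X\<close>
      meets \<open>block \<alpha>\<close> in the piece of \<open>\<alpha>\<close> alone. With mere
      almost disjointness, small errors from many indices could accumulate.\<close>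
    define X where "X = (\<Union>\<alpha>\<in>T. p (D1 \<alpha>) \<inter> block \<alpha>)"
    have XU: "X \<subseteq> U"
      by (auto simp: X_def block_def)
    define A where "A = q X"
    have AU: "A \<subseteq> U"
      using XU by (simp add: A_def q_subset)
    have "|{\<beta> \<in> D \<alpha>. (\<beta> \<in> A) \<noteq> f \<alpha> \<beta>}| <o k" if \<alpha>: "\<alpha> \<in> T" for \<alpha>
    proof -
      \<comment> \<open>Almost all points where \<open>f \<alpha>\<close> is true belong to
        \<open>A\<close>.\<close>
      have "p (D1 \<alpha>) \<lesssim> p (D1 \<alpha>) \<inter> block \<alpha>"
        using D1D block[OF \<alpha>] by (meson sub_Int sub_subset sub_trans subset_refl)
      also have "\<dots> \<lesssim> X"
        by (rule sub_subset) (use \<alpha> in \<open>auto simp: X_def\<close>)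
      also have "X \<lesssim> p A"
        unfolding A_def using XU by (rule pq_ge)
      finally have 1: "D1 \<alpha> \<lesssim> A"
        using p_reflects AU by simp
      \<comment> \<open>Conversely, the image of \<open>D \<alpha> \<inter> A\<close> lies almost in
        \<open>block \<alpha> \<inter> X\<close>, which is contained in
        \<open>p (D1 \<alpha>)\<close>.\<close>
      have sub: "D \<alpha> \<inter> A \<subseteq> U"
        using AU by blast
      have "p (D \<alpha> \<inter> A) \<lesssim> p (D \<alpha>)"
        by (rule p_mono[OF sub]) (auto intro: sub_subset)
      then have "p (D \<alpha> \<inter> A) \<lesssim> block \<alpha>"
        using block[OF \<alpha>] sub_trans by blast
      moreover have "p (D \<alpha> \<inter> A) \<lesssim> X"
      proof -
        have "p (D \<alpha> \<inter> A) \<lesssim> p A"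
          by (rule p_mono[OF sub AU]) (auto intro: sub_subset)
        then show ?thesis
          unfolding A_def using pq_le[OF XU] sub_trans by blast
      qed
      ultimately have "p (D \<alpha> \<inter> A) \<lesssim> block \<alpha> \<inter> X"
        by (rule sub_Int)
      also have "block \<alpha> \<inter> X \<lesssim> p (D1 \<alpha>)"
        by (rule sub_subset) (use disjoint \<alpha> in \<open>auto simp: X_def\<close>)
      finally have 2: "D \<alpha> \<inter> A \<lesssim> D1 \<alpha>"
        using p_reflects sub by simp
      have "{\<beta> \<in> D \<alpha>. (\<beta> \<in> A) \<noteq> f \<alpha> \<beta>} \<subseteq> (D1 \<alpha> - A) \<union> (D \<alpha> \<inter> A - D1 \<alpha>)"
        by (auto simp: D1_def)
      then show ?thesis
        using 1 2 small_Un small_mono unfolding almost_subset_def by blast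
    qed
    then show "\<exists>F. \<forall>\<alpha>\<in>T. |{\<beta> \<in> D \<alpha>. F \<beta> \<noteq> f \<alpha> \<beta>}| <o k"
      by (intro exI[of _ "\<lambda>\<beta>. \<beta> \<in> A"]) blast
  qed
  ultimately show ?thesis by blast
qed

section \<open>Lifting an automorphism to sets\<close>

text \<open>Representatives of the image classes are chosen. Almost inclusion of \<open>A\<close> in
  \<open>B\<close> means that \<open>A \<inter> B\<close> and \<open>A\<close> have the same class,
  so preservation of meets and injectivity of \<open>\<pi>\<close> make \<open>p\<close> preserve
  and reflect it.\<close>

lemma quot_automorphism_lift:
  assumes k: "Card_order k" "infinite (Field k)" and \<pi>: "quot_automorphism k U \<pi>"
  obtains p q where "almost_iso k U p q"
    "\<And>A. A \<subseteq> U \<Longrightarrow> \<pi> (cls k U A) = cls k U (p A)"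
    "\<And>A. A \<subseteq> U \<Longrightarrow> inv_into (quot k U) \<pi> (cls k U A) = cls k U (q A)"
proof -
  have bij: "bij_betw \<pi> (quot k U) (quot k U)"
    and meet: "\<And>X Y. X \<in> quot k U \<Longrightarrow> Y \<in> quot k U \<Longrightarrow>
      \<pi> (quot_meet k U X Y) = quot_meet k U (\<pi> X) (\<pi> Y)"
    using \<pi> by (auto simp: quot_automorphism_def)
  let ?\<rho> = "inv_into (quot k U) \<pi>"
  have cls_quot: "cls k U A \<in> quot k U" if "A \<subseteq> U" for A
    using that by (auto simp: quot_def cls_def intro: quotientI)
  have quot_cls: "\<exists>A\<subseteq>U. X = cls k U A" if "X \<in> quot k U" for X
    using that by (auto simp: quot_def cls_def elim!: quotientE)
  have lift: "\<exists>p. \<forall>A. A \<subseteq> U \<longrightarrow> p A \<subseteq> U \<and> \<sigma> (cls k U A) = cls k U (p A)"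
    if \<sigma>: "bij_betw \<sigma> (quot k U) (quot k U)" for \<sigma>
  proof (rule choice, rule allI)
    fix A
    show "\<exists>B. A \<subseteq> U \<longrightarrow> B \<subseteq> U \<and> \<sigma> (cls k U A) = cls k U B"
    proof (cases "A \<subseteq> U")
      case True
      then have "\<sigma> (cls k U A) \<in> quot k U"
        using \<sigma> cls_quot bij_betw_apply by metis
      then show ?thesis
        using quot_cls by blast
    qed simp
  qed
  obtain p where "\<forall>A. A \<subseteq> U \<longrightarrow> p A \<subseteq> U \<and> \<pi> (cls k U A) = cls k U (p A)"
    using lift[OF bij] by (elim exE)
  then have p: "\<And>A. A \<subseteq> U \<Longrightarrow> p A \<subseteq> U"
      "\<And>A. A \<subseteq> U \<Longrightarrow> \<pi> (cls k U A) = cls k U (p A)"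
    by auto
  obtain q where "\<forall>A. A \<subseteq> U \<longrightarrow> q A \<subseteq> U \<and> ?\<rho> (cls k U A) = cls k U (q A)"
    using lift[OF bij_betw_inv_into[OF bij]] by (elim exE)
  then have q: "\<And>A. A \<subseteq> U \<Longrightarrow> q A \<subseteq> U"
      "\<And>A. A \<subseteq> U \<Longrightarrow> ?\<rho> (cls k U A) = cls k U (q A)"
    by auto
  note eq = cls_eq_iff[OF k, of _ U]
  have sub_iff: "almost_subset k A B \<longleftrightarrow> cls k U (A \<inter> B) = cls k U A"
    if "A \<subseteq> U" "B \<subseteq> U" for A B
    using that eq[of "A \<inter> B" A]
    by (simp add: almost_subset_def le_infI1 Diff_Int Int_Diff small_empty[OF k])
  have pq: "cls k U (p (q A)) = cls k U A" if "A \<subseteq> U" for A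
    using that p(2)[of "q A"] q bij_betw_inv_into_right[OF bij cls_quot] by simp
  have qp: "cls k U (q (p A)) = cls k U A" if "A \<subseteq> U" for A
    using that q(2)[of "p A"] p bij_betw_inv_into_left[OF bij cls_quot] by metis
  have p_meet: "cls k U (p (A \<inter> B)) = cls k U (p A \<inter> p B)" if "A \<subseteq> U" "B \<subseteq> U" for A B
  proof -
    have "cls k U (p (A \<inter> B)) = \<pi> (quot_meet k U (cls k U A) (cls k U B))"
      using that p(2)[of "A \<inter> B"] by (simp add: le_infI1 quot_meet_cls[OF k])
    also have "\<dots> = quot_meet k U (cls k U (p A)) (cls k U (p B))"
      using that meet[OF cls_quot cls_quot] p(2) by simp
    also have "\<dots> = cls k U (p A \<inter> p B)"
      using that p(1) by (intro quot_meet_cls[OF k])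
    finally show ?thesis .
  qed
  have p_iff: "almost_subset k (p A) (p B) \<longleftrightarrow> almost_subset k A B" if "A \<subseteq> U" "B \<subseteq> U" for A B
  proof -
    have AB: "A \<inter> B \<subseteq> U" using that by blast
    have "almost_subset k (p A) (p B) \<longleftrightarrow> \<pi> (cls k U (A \<inter> B)) = \<pi> (cls k U A)"
      using that sub_iff[of "p A" "p B"] p p_meet AB by simp
    also have "\<dots> \<longleftrightarrow> cls k U (A \<inter> B) = cls k U A"
      by (rule inj_on_eq_iff[OF bij_betw_imp_inj_on[OF bij] cls_quot[OF AB] cls_quot[OF that(1)]])
    finally show ?thesis
      using sub_iff that by simp
  qed
  have cong: "almost_subset k A B \<longleftrightarrow> almost_subset k A' B'"
    if "A \<subseteq> U" "B \<subseteq> U" "A' \<subseteq> U" "B' \<subseteq> U" "cls k U A = cls k U A'" "cls k U B = cls k U B'"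
    for A B A' B'
    using that quot_le_cls[OF k, of A U B] quot_le_cls[OF k, of A' U B']
    by (simp add: almost_subset_def)
  \<comment> \<open>Since \<open>p\<close> reflects almost inclusion, the claim may be checked after
    applying \<open>p\<close>, where \<open>p (q A)\<close> and \<open>A\<close> have the same
    class.\<close>
  have q_mono: "almost_subset k (q A) (q B)" if "A \<subseteq> U" "B \<subseteq> U" "almost_subset k A B" for A B
    using that p_iff[of "q A" "q B"] cong[of "p (q A)" "p (q B)" A B] p q pq by simp
  have "almost_iso k U p q"
  proof
    fix A assume A: "A \<subseteq> U"
    show "almost_subset k (p (q A)) A" "almost_subset k A (p (q A))"
      using pq[OF A] eq[of "p (q A)" A] p q A by (auto simp: almost_subset_def)
    show "almost_subset k (q (p A)) A" "almost_subset k A (q (p A))"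
      using qp[OF A] eq[of "q (p A)" A] p q A by (auto simp: almost_subset_def)
  qed (use k p q p_iff q_mono in auto)
  then show thesis
    using p(2) q(2) by (rule that)
qed

theorem theorem7p1:
  fixes \<kappa> :: "'k rel"
    and \<pi> :: "'k set set set \<Rightarrow> 'k set set set"
    and C S :: "'k set set"
  assumes "Card_order \<kappa>" and "infinite (Field \<kappa>)" and "regularCard \<kappa>"
    and "quot_automorphism \<kappa> (Field (cardSuc \<kappa>)) \<pi>"
    and "card_preserving \<kappa> (Field (cardSuc \<kappa>)) \<pi>"
    and "C = {\<beta>. closure_point \<kappa> (cardSuc \<kappa>) \<pi> \<beta>}"
    and "S = {\<alpha> \<in> C. \<not> fixed_point \<kappa> (cardSuc \<kappa>) \<pi> \<alpha>}"
  shows "\<exists>S\<^sub>0 S\<^sub>1. S = S\<^sub>0 \<union> S\<^sub>1 \<and>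
           (\<exists>L. ladder_system (cardSuc \<kappa>) S\<^sub>0 L \<and> two_uniformization \<kappa> S\<^sub>0 L) \<and>
           (\<exists>L. ladder_system (cardSuc \<kappa>) S\<^sub>1 L \<and> two_uniformization \<kappa> S\<^sub>1 L)"
proof -
  let ?W = "cardSuc \<kappa>"
  let ?U = "Field ?W"
  note k = assms(1,2)
  have W: "Well_order ?W"
    using cardSuc_Card_order[OF k(1)] by (simp add: card_order_on_def)
  have us: "underS ?W \<alpha> \<subseteq> ?U" for \<alpha>
    by (auto simp: underS_def Field_def)
  obtain p q where iso: "almost_iso \<kappa> ?U p q"
    and p: "\<And>A. A \<subseteq> ?U \<Longrightarrow> \<pi> (cls \<kappa> ?U A) = cls \<kappa> ?U (p A)"
    and q: "\<And>A. A \<subseteq> ?U \<Longrightarrow> inv_into (quot \<kappa> ?U) \<pi> (cls \<kappa> ?U A) = cls \<kappa> ?U (q A)"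
    using quot_automorphism_lift[OF k assms(4)] by blast
  interpret P: almost_iso \<kappa> ?U p q by (rule iso)
  \<comment> \<open>The exchanged roles give the uniformization result for the inverse of
    \<open>\<pi>\<close>.\<close>
  interpret Q: almost_iso \<kappa> ?U q p
    by unfold_locales
      (use k P.p_subset P.q_subset P.p_mono P.q_mono P.pq_le P.pq_ge P.qp_le P.qp_ge in auto)
  have C_sub: "C \<subseteq> ?U"
    using assms(6) by (auto simp: closure_point_def)
  have closed:
    "almost_subset \<kappa> (p (underS ?W \<gamma>)) (underS ?W \<alpha>)"
    "almost_subset \<kappa> (q (underS ?W \<gamma>)) (underS ?W \<alpha>)"
    if "\<alpha> \<in> C" "\<gamma> \<in> underS ?W \<alpha>" for \<alpha> \<gamma>
  proof -
    have "quot_le \<kappa> (cls \<kappa> ?U (p (underS ?W \<gamma>))) (cls \<kappa> ?U (underS ?W \<alpha>))"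
      "quot_le \<kappa> (cls \<kappa> ?U (q (underS ?W \<gamma>))) (cls \<kappa> ?U (underS ?W \<alpha>))"
      using that p[OF us] q[OF us] assms(6) by (auto simp: closure_point_def quot_less_def)
    then show "almost_subset \<kappa> (p (underS ?W \<gamma>)) (underS ?W \<alpha>)"
      "almost_subset \<kappa> (q (underS ?W \<gamma>)) (underS ?W \<alpha>)"
      using quot_le_cls[OF k P.p_subset[OF us] us] quot_le_cls[OF k P.q_subset[OF us] us]
      by (auto simp: almost_subset_def)
  qed
  \<comment> \<open>A closure point that is not fixed is moved outward by \<open>p\<close> or by
    \<open>q\<close>; the two sets may overlap.\<close>
  define S0 where "S0 = {\<alpha> \<in> C. \<not> almost_subset \<kappa> (p (underS ?W \<alpha>)) (underS ?W \<alpha>)}"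
  define S1 where "S1 = {\<alpha> \<in> C. \<not> almost_subset \<kappa> (q (underS ?W \<alpha>)) (underS ?W \<alpha>)}"
  have fixed_iff: "fixed_point \<kappa> ?W \<pi> \<alpha> \<longleftrightarrow>
      almost_subset \<kappa> (p (underS ?W \<alpha>)) (underS ?W \<alpha>) \<and>
      almost_subset \<kappa> (q (underS ?W \<alpha>)) (underS ?W \<alpha>)" for \<alpha>
  proof -
    let ?A = "underS ?W \<alpha>"
    \<comment> \<open>Being fixed consists of two almost inclusions between \<open>p ?A\<close> and
      \<open>?A\<close>. Applying \<open>q\<close> one way and \<open>p\<close> the other, then
      cancelling, turns the second into a condition on \<open>q\<close> of the same shape as the
      first.\<close>
    have "almost_subset \<kappa> ?A (p ?A) \<longleftrightarrow> almost_subset \<kappa> (q ?A) ?A"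
      by (meson us P.p_subset P.q_subset P.p_mono P.q_mono P.qp_le P.pq_ge P.sub_trans)
    then show ?thesis
      unfolding fixed_point_def p[OF us] cls_eq_iff[OF k P.p_subset[OF us] us]
      by (simp add: almost_subset_def)
  qed
  have "S = S0 \<union> S1"
    unfolding assms(7) S0_def S1_def fixed_iff by blast
  moreover have "\<exists>L. ladder_system ?W S0 L \<and> two_uniformization \<kappa> S0 L"
    by (rule P.two_uniformization_of_moved_points[OF assms(3) W refl])
      (use C_sub closed in \<open>auto simp: S0_def\<close>)
  moreover have "\<exists>L. ladder_system ?W S1 L \<and> two_uniformization \<kappa> S1 L"
    by (rule Q.two_uniformization_of_moved_points[OF assms(3) W refl])
      (use C_sub closed in \<open>auto simp: S1_def\<close>)
  ultimately show ?thesis by blast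
qed

end
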